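(* Let $g(z)=\dfrac{z}{1+\frac12 z^3}$ for $z\in\mathbb{D}$. Then $g$ is not convex in any direction; that is, there is no $\gamma\in[0,\pi)$ such that $g$ is convex in the direction $\gamma$.
   Context: $\mathbb{D}=\{z\in\mathbb{C}:|z|<1\}$. A domain $D\subset\mathbb{C}$ is convex in the direction $\gamma$ ($0\le\gamma<\pi$) if every line parallel to the line through $0$ and $e^{i\gamma}$ has a connected (possibly empty) intersection with $D$. A univalent analytic function $f$ in $\mathbb{D}$ is convex in the direction $\gamma$ if $f(\mathbb{D})$ is convex in the direction $\gamma$. The function $g$ is univalent in $\mathbb{D}$, so the statement concerns the domain $g(\mathbb{D})$. *)

theory Defs
  imports "HOL-Complex_Analysis.Complex_Analysis"
begin

definition line_in_direction :: "real \<Rightarrow> complex \<Rightarrow> complex set" where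
  "line_in_direction \<gamma> a = {a + of_real t * exp (\<i> * of_real \<gamma>) | t :: real. True}"

definition domain_convex_in_direction :: "real \<Rightarrow> complex set \<Rightarrow> bool" where
  "domain_convex_in_direction \<gamma> D \<longleftrightarrow> (\<forall>a. connected (D \<inter> line_in_direction \<gamma> a))"

(* The notion is meant for functions analytic and univalent in the unit disc. Univalence is a
   precondition and deliberately not a conjunct: otherwise a non-univalent function would
   count as "not convex in the direction \<gamma>" for a reason unrelated to its image. *)
definition convex_in_direction :: "real \<Rightarrow> (complex \<Rightarrow> complex) \<Rightarrow> bool" where
  "convex_in_direction \<gamma> f \<longleftrightarrow> domain_convex_in_direction \<gamma> (f ` ball 0 1)"

end

theory Submission imports Defs begin

text \<open>
  The boundary of the image has inward cusps at the points \<open>2/3 \<omega>\<close> with \<open>\<omega> ^ 3 = 1\<close>,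
  because \<open>g z - 2/3\<close> is a multiple of \<open>(z - 1)\<^sup>2\<close>. A line through the cusp \<open>2/3\<close> that is at least
  as steep as the diagonals meets the image above and below the real axis, but meets the real axis
  only in the omitted value \<open>2/3\<close>. As \<open>g (\<omega> z) = \<omega> g z\<close>, it remains to see that every line
  direction \<open>e\<close> becomes steep after rotation by a third root of unity: steepness of \<open>u\<close> means
  \<open>Re (u\<^sup>2) \<le> 0\<close>, and the numbers \<open>(e \<omega>)\<^sup>2\<close> add up to \<open>0\<close>.
\<close>

definition cusp_map :: "complex \<Rightarrow> complex" where
  "cusp_map z = z / (1 + (1/2) * z ^ 3)"

lemma cusp_map_denominator_nonzero:
  assumes "norm z < 1"
  shows "1 + (1/2) * z ^ 3 \<noteq> (0::complex)"
proof
  assume "1 + (1/2) * z ^ 3 = 0"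
  then have "z ^ 3 = -2"
    by (simp add: add_eq_0_iff field_simps)
  then have "norm z ^ 3 = 2"
    by (metis norm_minus_cancel norm_numeral norm_power)
  moreover have "norm z ^ 3 \<le> 1"
    using assms by (simp add: power_le_one)
  ultimately show False
    by simp
qed

lemma cusp_map_rotate:
  assumes "\<omega> ^ 3 = 1"
  shows "cusp_map (\<omega> * z) = \<omega> * cusp_map z"
  using assms by (simp add: cusp_map_def power_mult_distrib)

lemma cusp_map_cnj: "cusp_map (cnj z) = cnj (cusp_map z)"
  by (simp add: cusp_map_def)

text \<open>Clearing the denominator gives \<open>z ^ 3 - 3 * z + 2 = 0\<close>, whose roots, 1
  (double, which produces the cusp) and -2, lie outside the open disc.\<close>

lemma cusp_map_omits:
  assumes "norm z < 1"
  shows "cusp_map z \<noteq> 2/3"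
proof
  assume "cusp_map z = 2/3"
  then have "2 * (3 * z) = 2 * (2 + z ^ 3)"
    using cusp_map_denominator_nonzero[OF assms] by (simp add: cusp_map_def field_simps)
  then have "3 * z = 2 + z ^ 3"
    by (simp only: mult_cancel_left) simp
  then have "(z - 1)\<^sup>2 * (z + 2) = 0"
    by (simp add: algebra_simps power2_eq_square power3_eq_cube)
  then have "z = 1 \<or> z = -2"
    by (auto simp: add_eq_0_iff2)
  then show False
    using assms by auto
qed

text \<open>Multiplying numerator and denominator by the conjugate denominator leaves a positive
  real denominator, so only the sign of \<open>Im (z * cnj ?d)\<close> matters.\<close>

lemma Im_cusp_map_pos:
  assumes "norm z < 1" "Im z > 0"
  shows "Im (cusp_map z) > 0"
proof -
  let ?d = "1 + (1/2) * z ^ 3"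
  have "Im (z * cnj ?d) = Im z * (1 - (norm z)\<^sup>2 * Re z)"
    unfolding cmod_power2 by (simp add: power2_eq_square power3_eq_cube field_simps)
  moreover have "(norm z)\<^sup>2 * Re z < 1"
  proof -
    have "(norm z)\<^sup>2 * Re z \<le> (norm z)\<^sup>2 * norm z"
      by (intro mult_left_mono complex_Re_le_cmod) simp
    also have "\<dots> = norm z ^ 3"
      by (simp add: power2_eq_square power3_eq_cube)
    also have "\<dots> < 1"
      using power_strict_mono[of "norm z" 1 3] assms by simp
    finally show ?thesis .
  qed
  ultimately have "Im (z * cnj ?d) > 0"
    using assms by simp
  moreover have "cusp_map z = z * cnj ?d / of_real ((norm ?d)\<^sup>2)"
    unfolding cusp_map_def by (metis complex_div_cnj of_real_power)
  moreover have "(norm ?d)\<^sup>2 > 0"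
    using cusp_map_denominator_nonzero[OF assms(1)] by simp
  ultimately show ?thesis
    by (simp only: Im_divide_of_real divide_pos_pos)
qed

lemma continuous_on_cusp_map:
  assumes "S \<subseteq> ball 0 1"
  shows "continuous_on S cusp_map"
  unfolding cusp_map_def
  using assms cusp_map_denominator_nonzero by (intro continuous_intros) auto

text \<open>An intermediate value argument on the connected image of the upper half disc. It has a
  point in each of the left and right closed quadrants cut out by the diagonals through 2/3, and a
  steep line through 2/3 weakly separates these quadrants.\<close>

lemma steep_line_meets_upper_half_image:
  assumes steep: "\<bar>Re u\<bar> \<le> \<bar>Im u\<bar>" and "u \<noteq> 0"
  obtains z t where "norm z < 1" "Im z > 0" "cusp_map z = 2/3 + of_real t * u"
proof -
  define S where "S = ball (0::complex) 1 \<inter> {z. Im z > 0}"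
  \<comment> \<open>This is \<open>\<i> * u\<close>, a normal of the line, so
    \<open>inner ?n\<close> is constant along it.\<close>
  let ?n = "Complex (- Im u) (Re u)"
  \<comment> \<open>Sample values, roughly 0.883 + 0.197i and -0.031 + 0.498i; any points of
    \<open>S\<close> whose images satisfy the two inequalities below would do.\<close>
  define p q where "p = cusp_map (Complex (3/4) (1/2))" and "q = cusp_map (\<i>/2)"
  have p: "Re p - 2/3 \<ge> \<bar>Im p\<bar>" and q: "2/3 - Re q \<ge> \<bar>Im q\<bar>"
    by (simp_all add: p_def q_def cusp_map_def Re_divide Im_divide power2_eq_square power3_eq_cube)
  have pS: "p \<in> cusp_map ` S" and qS: "q \<in> cusp_map ` S"
    by (auto simp: p_def q_def S_def cmod_def power2_eq_square real_sqrt_lt_1_iff)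
  have "convex S"
    unfolding S_def by (intro convex_Int convex_ball convex_halfspace_Im_gt)
  then have conn: "connected (cusp_map ` S)"
    by (intro connected_continuous_image continuous_on_cusp_map convex_connected)
       (auto simp: S_def)
  have inner: "inner ?n w = Im w * Re u - Re w * Im u" for w
    by (simp add: inner_complex_def algebra_simps)
  have bound: "\<bar>Im w * Re u\<bar> \<le> \<bar>Re w - 2/3\<bar> * \<bar>Im u\<bar>" if "\<bar>Im w\<bar> \<le> \<bar>Re w - 2/3\<bar>" for w
    unfolding abs_mult using that steep by (intro mult_mono) auto
  have bp: "\<bar>Im p * Re u\<bar> \<le> (Re p - 2/3) * \<bar>Im u\<bar>"
    using bound[of p] p by auto
  have bq: "\<bar>Im q * Re u\<bar> \<le> (2/3 - Re q) * \<bar>Im u\<bar>"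
    using bound[of q] q by auto
  have "\<exists>w \<in> cusp_map ` S. inner ?n w = inner ?n (2/3)"
  \<comment> \<open>The sign of \<open>Im u\<close> decides which of \<open>p\<close> and
    \<open>q\<close> lies on the lower side of the line with respect to \<open>?n\<close>.\<close>
  proof (cases "Im u \<ge> 0")
    case True
    then show ?thesis
      using bp bq
      by (intro connected_ivt_hyperplane[OF conn pS qS]) (auto simp: inner algebra_simps)
  next
    case False
    then show ?thesis
      using bp bq
      by (intro connected_ivt_hyperplane[OF conn qS pS]) (auto simp: inner algebra_simps)
  qed
  then obtain z where z: "z \<in> S"
    and eq: "Im (cusp_map z) * Re u = (Re (cusp_map z) - 2/3) * Im u"
    by (auto simp: inner algebra_simps)
  have "Im u \<noteq> 0"
    using assms by (auto simp: complex_eq_iff)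
  then have "cusp_map z = 2/3 + of_real (Im (cusp_map z) / Im u) * u"
    using eq by (simp add: complex_eq_iff field_simps)
  with z that show thesis
    unfolding S_def by (metis IntE mem_Collect_eq mem_ball_0)
qed

lemma disconnected_line_through_cusp:
  assumes "\<omega> ^ 3 = 1" and steep: "\<bar>Re u\<bar> \<le> \<bar>Im u\<bar>" and "u \<noteq> 0"
  shows "\<not> connected (cusp_map ` ball 0 1 \<inter>
           {\<omega> * (2/3) + of_real t * (\<omega> * u) | t. True})" (is "\<not> connected ?C")
proof
  assume conn: "connected ?C"
  have w_nz: "\<omega> \<noteq> 0"
    using assms(1) by auto
  have norm_w: "norm \<omega> = 1"
    using assms(1) by (metis norm_one norm_power power_eq_1_iff norm_ge_zero zero_neq_numeral)
  \<comment> \<open>The normal of the rotated real axis: since \<omega> has modulus 1,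
    \<open>inner ?n\<close> reads off the imaginary part before rotation.\<close>
  let ?n = "\<i> * \<omega>"
  have inner: "inner ?n (\<omega> * x) = Im x" for x
  proof -
    have "inner ?n (\<omega> * x) = (norm \<omega>)\<^sup>2 * Im x"
      unfolding cmod_power2 by (simp add: inner_complex_def algebra_simps power2_eq_square)
    with norm_w show ?thesis by simp
  qed
  have mem: "\<omega> * cusp_map z \<in> ?C" if "norm z < 1" "cusp_map z = 2/3 + of_real t * u" for z t
  proof -
    have "\<omega> * cusp_map z = cusp_map (\<omega> * z)"
      using cusp_map_rotate[OF assms(1)] by simp
    moreover have "\<omega> * z \<in> ball 0 1"
      using that norm_w by (simp add: norm_mult)
    moreover have "\<omega> * cusp_map z = \<omega> * (2/3) + of_real t * (\<omega> * u)"
      using that by (simp add: algebra_simps)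
    ultimately show ?thesis
      by (metis (mono_tags, lifting) IntI imageI mem_Collect_eq)
  qed
  obtain z t where z: "norm z < 1" "Im z > 0" "cusp_map z = 2/3 + of_real t * u"
    using steep_line_meets_upper_half_image[OF steep \<open>u \<noteq> 0\<close>] .
  \<comment> \<open>Steepness is invariant under conjugation. Conjugating a point found for
    \<open>cnj u\<close> gives a point of the original line below the real axis.\<close>
  obtain z' t' where z': "norm z' < 1" "Im z' > 0" "cusp_map z' = 2/3 + of_real t' * cnj u"
    using steep_line_meets_upper_half_image[of "cnj u"] assms by auto
  have up: "\<omega> * cusp_map z \<in> ?C"
    using mem z by blast
  have "cusp_map (cnj z') = 2/3 + of_real t' * u"
    unfolding cusp_map_cnj z'(3) by simp
  then have low: "\<omega> * cusp_map (cnj z') \<in> ?C"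
    by (intro mem[where t = t']) (simp_all add: z'(1))
  have "\<exists>w \<in> ?C. inner ?n w = 0"
    using Im_cusp_map_pos[OF z(1,2)] Im_cusp_map_pos[OF z'(1,2)]
    by (intro connected_ivt_hyperplane[OF conn low up]) (simp_all only: inner cusp_map_cnj, simp_all)
  then obtain w where w: "w \<in> ?C" "inner ?n w = 0"
    by blast
  from w(1) obtain y where y: "norm y < 1" "w = cusp_map y"
    by auto
  from w(1) obtain s where "w = \<omega> * (2/3) + of_real s * (\<omega> * u)"
    by blast
  then have s: "w = \<omega> * (2/3 + of_real s * u)"
    by (simp add: algebra_simps)
  \<comment> \<open>Steepness and \<open>u \<noteq> 0\<close> give \<open>Im u \<noteq> 0\<close>,
    which forces \<open>s = 0\<close>. Hence \<open>w\<close> is the cusp itself, and rotating back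
    by \<open>inverse \<omega>\<close> makes 2/3 a value on the disc.\<close>
  have "Im (2/3 + of_real s * u) = 0"
    using w(2) unfolding s inner .
  moreover have "Im u \<noteq> 0"
    using assms by (auto simp: complex_eq_iff)
  ultimately have "cusp_map y = \<omega> * (2/3)"
    using s y(2) by simp
  moreover have "(inverse \<omega>) ^ 3 = 1"
    using assms(1) by (simp add: power_inverse)
  ultimately have "cusp_map (inverse \<omega> * y) = 2/3"
    using w_nz by (simp only: cusp_map_rotate mult.assoc[symmetric]) simp
  moreover have "norm (inverse \<omega> * y) < 1"
    using y(1) norm_w by (simp add: norm_mult norm_inverse)
  ultimately show False
    using cusp_map_omits by blast
qed

lemma steep_after_rotation:
  fixes e :: complex
  obtains \<omega> u where "\<omega> ^ 3 = 1" "e = \<omega> * u" "\<bar>Re u\<bar> \<le> \<bar>Im u\<bar>"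
proof -
  define \<eta> where "\<eta> = Complex (-1/2) (sqrt 3 / 2)"
  have \<eta>2: "\<eta>\<^sup>2 = - 1 - \<eta>"
    by (simp add: \<eta>_def complex_eq_iff power2_eq_square)
  have \<eta>3: "\<eta> ^ 3 = 1"
  proof -
    have "\<eta> ^ 3 = \<eta> * \<eta>\<^sup>2"
      by (simp add: power2_eq_square power3_eq_cube)
    also have "\<dots> = \<eta> * (- 1 - \<eta>)"
      by (simp only: \<eta>2)
    also have "\<dots> = - \<eta> - \<eta>\<^sup>2"
      by (simp add: power2_eq_square algebra_simps)
    finally show ?thesis
      by (simp add: \<eta>2)
  qed
  have "e\<^sup>2 + (\<eta> * e)\<^sup>2 + (\<eta>\<^sup>2 * e)\<^sup>2 = e\<^sup>2 * (1 + \<eta>\<^sup>2 + \<eta> * \<eta> ^ 3)"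
    by (simp add: algebra_simps power2_eq_square power3_eq_cube)
  also have "\<dots> = 0"
    by (simp add: \<eta>2 \<eta>3)
  finally have "Re (e\<^sup>2) + Re ((\<eta> * e)\<^sup>2) + Re ((\<eta>\<^sup>2 * e)\<^sup>2) = 0"
    by (metis plus_complex.sel(1) zero_complex.sel(1))
  then consider "Re (e\<^sup>2) \<le> 0" | "Re ((\<eta> * e)\<^sup>2) \<le> 0" | "Re ((\<eta>\<^sup>2 * e)\<^sup>2) \<le> 0"
    by linarith
  moreover have steep: "\<bar>Re u\<bar> \<le> \<bar>Im u\<bar>" if "Re (u\<^sup>2) \<le> 0" for u
    using that by (simp add: Re_power2 abs_le_square_iff)
  ultimately show thesis
  proof cases
    case 1
    then show thesis using that[of 1 e] steep by simp
  next
    case 2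
    \<comment> \<open>The roots \<eta> and \<open>\<eta>\<^sup>2\<close> are inverse to each other,
      so the factor that made \<open>e\<close> steep is undone by the other one.\<close>
    have "(\<eta>\<^sup>2) ^ 3 = 1"
      by (metis \<eta>3 power_commutes power_mult mult.commute power_one)
    moreover have "e = \<eta>\<^sup>2 * (\<eta> * e)"
      using \<eta>3 by (simp add: power2_eq_square power3_eq_cube mult.assoc[symmetric])
    ultimately show thesis using that[of "\<eta>\<^sup>2" "\<eta> * e"] steep[OF 2] by simp
  next
    case 3
    have "e = \<eta> * (\<eta>\<^sup>2 * e)"
      using \<eta>3 by (simp add: power2_eq_square power3_eq_cube mult.assoc[symmetric])
    then show thesis using that[of \<eta> "\<eta>\<^sup>2 * e"] steep[OF 3] \<eta>3 by simp
  qed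
qed

theorem mainTheorem3:
  fixes g :: "complex \<Rightarrow> complex"
  assumes "\<And>z. z \<in> ball 0 1 \<Longrightarrow> g z = z / (1 + (1/2) * z ^ 3)"
  shows "\<not> (\<exists>\<gamma>::real. 0 \<le> \<gamma> \<and> \<gamma> < pi \<and> convex_in_direction \<gamma> g)"
proof
  assume "\<exists>\<gamma>::real. 0 \<le> \<gamma> \<and> \<gamma> < pi \<and> convex_in_direction \<gamma> g"
  then obtain \<gamma> :: real where conv: "convex_in_direction \<gamma> g"
    by blast
  have img: "g ` ball 0 1 = cusp_map ` ball 0 1"
    using assms by (intro image_cong) (auto simp: cusp_map_def)
  obtain \<omega> u where u: "\<omega> ^ 3 = 1" "exp (\<i> * of_real \<gamma>) = \<omega> * u" "\<bar>Re u\<bar> \<le> \<bar>Im u\<bar>"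
    using steep_after_rotation .
  have "u \<noteq> 0"
    using u(2) by (metis exp_not_eq_zero mult_zero_right)
  \<comment> \<open>The root \<omega> chosen for this direction selects the cusp through which the
    line is drawn.\<close>
  moreover have "connected (cusp_map ` ball 0 1 \<inter> line_in_direction \<gamma> (\<omega> * (2/3)))"
    using conv by (simp add: convex_in_direction_def domain_convex_in_direction_def img)
  ultimately show False
    using disconnected_line_through_cusp[OF u(1,3)] by (simp add: line_in_direction_def u(2))
qed

end
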